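(* Let $T$ be a tree that is uniquely distinguishing colorable and satisfies $\chi_D(T)\geq 3$. Then $T$ is a star graph.
   Context: A distinguishing $k$-coloring of a graph $G$ is a partition of $V(G)$ into exactly $k$ non-empty independent sets such that the only automorphism of $G$ mapping every class onto itself is the identity. $\chi_D(G)$ is the least such $k$. $G$ is uniquely distinguishing colorable if there is exactly one partition of $V(G)$ into $\chi_D(G)$ classes forming a distinguishing coloring. *)

theory Defs
  imports "Graph_Theory.Graph_Theory" "HOL-Library.Disjoint_Sets"
begin

text \<open>
  A finite simple undirected graph is a \<open>pair_graph\<close>: finitely many vertices, no loops, and a
  symmetric arc relation, so that the edge \<open>uv\<close> is the pair of arcs \<open>(u, v)\<close>, \<open>(v, u)\<close>.
\<close>

definition automorphism :: "'a pair_pre_digraph \<Rightarrow> ('a \<Rightarrow> 'a) \<Rightarrow> bool" where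
  "automorphism G f \<longleftrightarrow> f permutes pverts G \<and>
     (\<forall>u\<in>pverts G. \<forall>v\<in>pverts G. (f u, f v) \<in> parcs G \<longleftrightarrow> (u, v) \<in> parcs G)"

definition independent :: "'a pair_pre_digraph \<Rightarrow> 'a set \<Rightarrow> bool" where
  "independent G A \<longleftrightarrow> A \<subseteq> pverts G \<and> (\<forall>u\<in>A. \<forall>v\<in>A. (u, v) \<notin> parcs G)"

text \<open>A coloring is the unlabelled set of its classes; \<open>partition_on\<close> makes them non-empty.\<close>

definition distinguishing_coloring :: "'a pair_pre_digraph \<Rightarrow> nat \<Rightarrow> 'a set set \<Rightarrow> bool" where
  "distinguishing_coloring G k P \<longleftrightarrow>
     partition_on (pverts G) P \<and> card P = k \<and> (\<forall>A\<in>P. independent G A) \<and>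
     (\<forall>f. automorphism G f \<and> (\<forall>A\<in>P. f ` A = A) \<longrightarrow> f = id)"

definition chi_D :: "'a pair_pre_digraph \<Rightarrow> nat" where
  "chi_D G = (LEAST k. \<exists>P. distinguishing_coloring G k P)"

definition uniquely_distinguishing_colorable :: "'a pair_pre_digraph \<Rightarrow> bool" where
  "uniquely_distinguishing_colorable G \<longleftrightarrow> (\<exists>!P. distinguishing_coloring G (chi_D G) P)"

text \<open>
  The library's \<open>forest\<close> and \<open>tree\<close> do not describe undirected trees here: in a symmetric digraph
  every edge gives a closed walk \<open>u, v, u\<close>, which \<open>cycle\<close> admits. The \<open>cycle\<close>s with at least
  three arcs are exactly the cycles of the undirected graph. Note that \<open>connected\<close> includes
  non-emptiness of the vertex set.
\<close>

definition undirected_tree :: "'a pair_pre_digraph \<Rightarrow> bool" where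
  "undirected_tree G \<longleftrightarrow> pair_graph G \<and> connected (with_proj G) \<and>
     (\<nexists>p. pre_digraph.cycle (with_proj G) p \<and> length p \<ge> 3)"

definition star :: "'a pair_pre_digraph \<Rightarrow> bool" where
  "star G \<longleftrightarrow> (\<exists>n\<ge>1. K\<^bsub>1,n\<^esub> (with_proj G))"

text \<open>The minimum in the definition of \<open>chi_D\<close> is attained: singleton classes distinguish.\<close>

lemma ex_distinguishing_coloring_chi_D:
  assumes "pair_graph G"
  shows "\<exists>P. distinguishing_coloring G (chi_D G) P"
proof -
  interpret pair_graph G by fact
  let ?P = "(\<lambda>v. {v}) ` pverts G"
  have "distinguishing_coloring G (card ?P) ?P"
    unfolding distinguishing_coloring_def
  proof (intro conjI allI impI ballI)
    show "partition_on (pverts G) ?P"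
      by (auto simp: partition_on_def disjoint_def)
    show "independent G A" if "A \<in> ?P" for A
      using that by (auto dest: pair_no_loops simp: independent_def)
    show "f = id" if "automorphism G f \<and> (\<forall>A\<in>?P. f ` A = A)" for f
    proof
      fix x show "f x = id x"
        using that by (cases "x \<in> pverts G") (auto simp: automorphism_def permutes_not_in)
    qed
  qed simp
  then have "\<exists>P. distinguishing_coloring G (card ?P) P" by blast
  then show ?thesis unfolding chi_D_def by (rule LeastI)
qed

end

theory Submission
  imports Defs
begin

text \<open>
  Let \<open>v\<close> be a leaf with neighbor \<open>u\<close>. As there is a third color, \<open>v\<close> can be recolored properly, and
  uniqueness forces the class of \<open>v\<close> to be \<open>{v}\<close>. Any other neighbor \<open>w\<close> of \<open>u\<close> can be given the
  color of \<open>v\<close>, and the new coloring must fail to be distinguishing because of an automorphism taking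
  \<open>w\<close> to \<open>v\<close>. So every neighbor of \<open>u\<close> is a leaf, and by connectedness the tree is a star.
\<close>

section \<open>Automorphisms and their action on colorings\<close>

lemma automorphism_comp:
  assumes "automorphism G f" "automorphism G g"
  shows "automorphism G (f \<circ> g)"
  using assms unfolding automorphism_def by (auto intro: permutes_compose simp: permutes_in_image)

lemma automorphism_inv:
  assumes "automorphism G f"
  shows "automorphism G (inv f)"
  unfolding automorphism_def
proof (intro conjI ballI)
  have f: "f permutes pverts G"
    using assms by (simp add: automorphism_def)
  then show inv: "inv f permutes pverts G"
    by (rule permutes_inv)
  fix u v assume "u \<in> pverts G" "v \<in> pverts G"
  then have "(f (inv f u), f (inv f v)) \<in> parcs G \<longleftrightarrow> (inv f u, inv f v) \<in> parcs G"
    using assms inv by (simp add: automorphism_def permutes_in_image)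
  then show "(inv f u, inv f v) \<in> parcs G \<longleftrightarrow> (u, v) \<in> parcs G"
    by (simp add: permutes_inverses[OF f])
qed

text \<open>Conjugation by \<open>f\<close> turns an automorphism fixing all image classes into one
  fixing all original classes. Under uniqueness this makes every automorphism permute the classes of
  the coloring.\<close>

lemma distinguishing_coloring_image:
  assumes P: "distinguishing_coloring G k P" and f: "automorphism G f"
  shows "distinguishing_coloring G k ((`) f ` P)"
  unfolding distinguishing_coloring_def
proof (intro conjI allI impI ballI)
  have perm: "f permutes pverts G"
    using f by (simp add: automorphism_def)
  then have inj: "inj f" and inv: "f (inv f x) = x" "inv f (f x) = x" for x
    by (auto intro: permutes_inj simp: permutes_inverses)
  have part: "partition_on (pverts G) P"
    using P by (simp add: distinguishing_coloring_def)
  \<comment> \<open>Removing \<open>{{}}\<close> only matches the form of the library rule: images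
    of non-empty classes are non-empty.\<close>
  have "partition_on (f ` pverts G) ((`) f ` P - {{}})"
    using part inj by (intro partition_on_inj_image) (auto simp: inj_on_def)
  moreover have "{} \<notin> (`) f ` P"
    using part by (auto simp: partition_on_def)
  ultimately show "partition_on (pverts G) ((`) f ` P)"
    by (simp add: permutes_image[OF perm])
  have "inj_on ((`) f) P"
    using inj by (simp add: inj_image_eq_iff inj_on_def)
  then show "card ((`) f ` P) = k"
    using P by (simp add: card_image distinguishing_coloring_def)
  show "independent G A" if "A \<in> (`) f ` P" for A
  proof -
    obtain B where B: "B \<in> P" "A = f ` B" using \<open>A \<in> _\<close> by blast
    then have "independent G B"
      using P by (simp add: distinguishing_coloring_def)
    then show ?thesis
      using f perm B(2) unfolding independent_def automorphism_def
      by (auto simp: permutes_in_image subset_iff)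
  qed
  show "g = id" if g: "automorphism G g \<and> (\<forall>A\<in>(`) f ` P. g ` A = A)" for g
  proof -
    have "automorphism G (inv f \<circ> g \<circ> f)"
      using f g by (auto intro: automorphism_comp automorphism_inv)
    moreover have "(inv f \<circ> g \<circ> f) ` A = A" if "A \<in> P" for A
    proof -
      have "g ` f ` A = f ` A" using g \<open>A \<in> P\<close> by blast
      then show ?thesis by (simp only: image_comp[symmetric] image_inv_f_f[OF inj])
    qed
    ultimately have "inv f \<circ> g \<circ> f = id"
      using P unfolding distinguishing_coloring_def by blast
    then have "g (f x) = f x" for x
      by (metis comp_apply id_apply inv(1))
    then have "g x = x" for x
      by (metis inv(1))
    then show ?thesis by auto
  qed
qed

section \<open>Moving one vertex to another class\<close>

text \<open>Intended for distinct classes \<open>A\<close>, \<open>B\<close> and \<open>w\<close> in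
  \<open>A\<close>. Subtracting \<open>{{}}\<close> drops the remainder \<open>A - {w}\<close> when
  it is empty, so that the result is still a partition.\<close>

definition recoloring :: "'a \<Rightarrow> 'a set \<Rightarrow> 'a set \<Rightarrow> 'a set set \<Rightarrow> 'a set set" where
  "recoloring w A B P = insert (insert w B) (P - {A, B} \<union> ({A - {w}} - {{}}))"

lemma partition_on_recoloring:
  assumes P: "partition_on V P" and AB: "A \<in> P" "B \<in> P" "A \<noteq> B" and w: "w \<in> A"
  shows "partition_on V (recoloring w A B P)"
  unfolding partition_on_def
proof (intro conjI disjointI)
  have dis: "C \<inter> D = {}" if "C \<in> P" "D \<in> P" "C \<noteq> D" for C D
    using P that by (auto simp: partition_on_def disjoint_def)
  have "\<Union> (recoloring w A B P) = \<Union> P"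
    using AB w by (auto simp: recoloring_def)
  then show "\<Union> (recoloring w A B P) = V"
    using P by (simp add: partition_on_def)
  show "{} \<notin> recoloring w A B P"
    using P by (auto simp: recoloring_def partition_on_def)
  define R where "R = P - {A, B} \<union> ({A - {w}} - {{}})"
  have recoloring: "recoloring w A B P = insert (insert w B) R"
    by (simp add: recoloring_def R_def)
  have new: "C \<inter> insert w B = {}" if "C \<in> R" for C
  proof (cases "C = A - {w}")
    case True
    then show ?thesis
      using dis[OF AB] by blast
  next
    case False
    then have "C \<in> P" "C \<noteq> A" "C \<noteq> B"
      using that by (auto simp: R_def)
    then show ?thesis
      using dis[of C A] dis[of C B] AB w by blast
  qed
  have old: "C \<inter> D = {}" if "C \<in> R" "D \<in> R" "C \<noteq> D" for C D
  proof -
    \<comment> \<open>An old class other than \<open>A\<close> is disjoint from \<open>A\<close>,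
      hence also from \<open>A - {w}\<close>.\<close>
    have R: "E \<in> P \<and> E \<noteq> A \<or> E = A - {w}" if "E \<in> R" for E
      using that by (auto simp: R_def)
    show ?thesis
      using R[OF that(1)] R[OF that(2)] that(3) dis[of C D] dis[of C A] dis[of A D] AB by blast
  qed
  show "C \<inter> D = {}" if CD: "C \<in> recoloring w A B P" "D \<in> recoloring w A B P" "C \<noteq> D" for C D
  proof -
    consider "C = insert w B" "D \<in> R" | "C \<in> R" "D = insert w B" | "C \<in> R" "D \<in> R"
      using CD unfolding recoloring by blast
    then show ?thesis
    proof cases
      case 1
      then show ?thesis
        using new[of D] by blast
    next
      case 2
      then show ?thesis
        using new[of C] by blast
    next
      case 3
      then show ?thesis
        using CD(3) by (rule old)
    qed
  qed
qed

text \<open>Two classes are removed; the enlarged \<open>B\<close> always comes back, the remainder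
  of \<open>A\<close> only if it is non-empty.\<close>

lemma card_recoloring:
  assumes P: "partition_on V P" "finite P" and AB: "A \<in> P" "B \<in> P" "A \<noteq> B" and w: "w \<in> A"
  shows "card (recoloring w A B P) = (if A = {w} then card P - 1 else card P)"
proof -
  have dis: "C \<inter> D = {}" if "C \<in> P" "D \<in> P" "C \<noteq> D" for C D
    using P that by (auto simp: partition_on_def disjoint_def)
  have card: "card (P - {A, B}) = card P - 2" "card P \<ge> 2"
    using P AB card_mono[of P "{A, B}"] by (auto simp: card_Diff_subset)
  \<comment> \<open>As a class, \<open>insert w B\<close> would meet both \<open>A\<close> and
    \<open>B\<close> and so equal both.\<close>
  have B: "insert w B \<notin> P" "B \<noteq> {}" "w \<notin> B"
    using dis[OF AB] dis[of A "insert w B"] dis[of B "insert w B"] AB w P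
    by (auto simp: partition_on_def)
  have "A - {w} \<notin> P - {A, B}" if "A \<noteq> {w}"
    using dis[of A "A - {w}"] that AB w by blast
  moreover have "insert w B \<noteq> A - {w}" by auto
  ultimately have "card (recoloring w A B P) = card (P - {A, B} \<union> ({A - {w}} - {{}})) + 1"
    using B(1) P(2) by (simp add: recoloring_def)
  also have "card (P - {A, B} \<union> ({A - {w}} - {{}})) = card P - 2 + (if A = {w} then 0 else 1)"
  proof (cases "A = {w}")
    case False
    then have "{A - {w}} - {{}} = {A - {w}}"
      using w by auto
    then show ?thesis
      using False P(2) \<open>A \<noteq> {w} \<Longrightarrow> A - {w} \<notin> P - {A, B}\<close> by (simp add: card(1))
  qed (use card in simp)
  finally show ?thesis
    using card(2) by (cases "A = {w}") simp_all
qed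

text \<open>
  If the new coloring were distinguishing, it would contradict uniqueness or, when
  \<open>A = {w}\<close>, minimality. A color-preserving automorphism \<open>f\<close> of the new coloring moves \<open>w\<close>, hence
  sends it into \<open>B\<close>; but \<open>f\<close> permutes the old classes by uniqueness, so \<open>A - {w}\<close>, which it
  preserves, must be empty.
\<close>

lemma recoloring_automorphism:
  assumes fin: "finite (pverts G)"
    and P: "distinguishing_coloring G (chi_D G) P"
    and unique: "\<And>Q. distinguishing_coloring G (chi_D G) Q \<Longrightarrow> Q = P"
    and AB: "A \<in> P" "B \<in> P" "A \<noteq> B" and w: "w \<in> A"
    and free: "\<And>x. x \<in> B \<Longrightarrow> (w, x) \<notin> parcs G \<and> (x, w) \<notin> parcs G"
  obtains f where "A = {w}" "automorphism G f" "f w \<in> B"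
proof -
  let ?Q = "recoloring w A B P"
  have part: "partition_on (pverts G) P" and card: "card P = chi_D G"
    and ind: "\<And>C. C \<in> P \<Longrightarrow> independent G C"
    and triv: "\<And>f. automorphism G f \<Longrightarrow> (\<And>C. C \<in> P \<Longrightarrow> f ` C = C) \<Longrightarrow> f = id"
    using P unfolding distinguishing_coloring_def by blast+
  have dis: "C \<inter> D = {}" if "C \<in> P" "D \<in> P" "C \<noteq> D" for C D
    using part that by (auto simp: partition_on_def disjoint_def)
  have "finite P"
    using fin part by (rule finite_elements)
  have "B \<noteq> {}"
    using part AB by (auto simp: partition_on_def)
  \<comment> \<open>The vertex \<open>w\<close> is not in \<open>B\<close>, and the non-empty
    \<open>B\<close> is disjoint from \<open>A - {w}\<close>, so neither new set equals
    \<open>B\<close>.\<close>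
  then have "B \<notin> ?Q"
    using dis[OF AB] w unfolding recoloring_def by auto
  then have "?Q \<noteq> P"
    using AB by auto
  have "card P > 0"
    using \<open>finite P\<close> AB by (auto simp: card_gt_0_iff)
  have "\<not> distinguishing_coloring G (card ?Q) ?Q"
  proof (cases "A = {w}")
    case True
    then have "card ?Q < chi_D G"
      using card_recoloring[OF part \<open>finite P\<close> AB w] card \<open>card P > 0\<close> by simp
    then show ?thesis
      unfolding chi_D_def using not_less_Least by blast
  next
    case False
    then have "card ?Q = chi_D G"
      using card_recoloring[OF part \<open>finite P\<close> AB w] card by simp
    then show ?thesis
      using unique \<open>?Q \<noteq> P\<close> by auto
  qed
  moreover have "partition_on (pverts G) ?Q"
    using part AB w by (rule partition_on_recoloring)
  moreover have "independent G C" if "C \<in> ?Q" for C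
    using that ind[OF AB(1)] ind[OF AB(2)] ind[of C] w free
    unfolding recoloring_def independent_def by auto
  ultimately have "\<not> (\<forall>f. automorphism G f \<and> (\<forall>C\<in>?Q. f ` C = C) \<longrightarrow> f = id)"
    by (simp add: distinguishing_coloring_def)
  then obtain f where f: "automorphism G f" "f \<noteq> id" and "\<forall>C\<in>?Q. f ` C = C"
    by metis
  then have fQ: "f ` C = C" if "C \<in> ?Q" for C
    using that by simp
  have inj: "inj f"
    using f by (auto simp: automorphism_def intro: permutes_inj)
  have fB: "f ` insert w B = insert w B"
    by (rule fQ) (simp add: recoloring_def)
  \<comment> \<open>An empty remainder is not a class of \<open>?Q\<close>, but then the equation is
    trivial.\<close>
  have fA: "f ` (A - {w}) = A - {w}"
    using fQ[of "A - {w}"] by (cases "A - {w} = {}") (auto simp: recoloring_def)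
  \<comment> \<open>If \<open>f\<close> fixed \<open>w\<close>, it would preserve \<open>A\<close>
    and \<open>B\<close> as well, hence every class of \<open>P\<close>, and be the
    identity.\<close>
  have "f w \<noteq> w"
  proof
    assume fw: "f w = w"
    have "f ` C = C" if "C \<in> P" for C
    proof -
      consider "C = A" | "C = B" | "C \<in> ?Q"
        using \<open>C \<in> P\<close> by (auto simp: recoloring_def)
      then show ?thesis
      proof cases
        case 1
        have "f ` A = insert (f w) (f ` (A - {w}))"
          using w by blast
        then show ?thesis
          using 1 fA fw w by auto
      next
        case 2
        have "w \<notin> B"
          using dis[OF AB] w by blast
        have "f ` B = f ` insert w B - {f w}"
          using \<open>w \<notin> B\<close> inj by (auto simp: inj_eq)
        also have "\<dots> = B"
          unfolding fB fw using \<open>w \<notin> B\<close> by simp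
        finally show ?thesis
          using 2 by simp
      qed (rule fQ)
    qed
    then show False
      using triv f by blast
  qed
  then have "f w \<in> B"
    using fB by blast
  moreover have "A = {w}"
  proof (rule ccontr)
    assume "A \<noteq> {w}"
    then obtain x where x: "x \<in> A - {w}"
      using w by blast
    then have "x \<in> f ` A"
      using fA by blast
    have "(`) f ` P = P"
      using unique distinguishing_coloring_image[OF P f(1)] by blast
    then have "f ` A \<in> P"
      using AB by blast
    \<comment> \<open>The image of \<open>A\<close> is an old class that shares \<open>x\<close>
      with \<open>A\<close>.\<close>
    then have "f ` A = A"
      using dis[of "f ` A" A] AB x \<open>x \<in> f ` A\<close> by blast
    then show False
      using dis[OF AB] w \<open>f w \<in> B\<close> by blast
  qed
  ultimately show thesis
    using f(1) that by blast
qed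

section \<open>Connectedness and leaves\<close>

text \<open>Symmetric arcs make connectedness strong, so every vertex is reachable from
  \<open>a\<close>, and reachability cannot leave \<open>S\<close>.\<close>

lemma connected_closed_superset:
  assumes G: "pair_graph G" "connected (with_proj G)"
    and a: "a \<in> S" "a \<in> pverts G"
    and closed: "\<And>u v. u \<in> S \<Longrightarrow> (u, v) \<in> parcs G \<Longrightarrow> v \<in> S"
  shows "pverts G \<subseteq> S"
proof
  interpret pair_graph G by fact
  fix b assume "b \<in> pverts G"
  have "strongly_connected (with_proj G)"
    using G(2) by (intro symmetric_connected_imp_strongly_connected) (rule sym_arcs)
  then have "a \<rightarrow>\<^sup>*\<^bsub>with_proj G\<^esub> b"
    using a \<open>b \<in> pverts G\<close> by (auto simp: strongly_connected_def)
  then show "b \<in> S"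
    by (induction rule: reachable_induct) (auto intro: a closed simp: arcs_ends_conv)
qed

text \<open>The first vertex of a longest path is a leaf: a second neighbor would either extend the
  path or close a cycle. The given arc ensures that a longest path is non-empty.\<close>

lemma undirected_tree_has_leaf:
  assumes T: "undirected_tree T" and arc: "(a, b) \<in> parcs T"
  obtains v u where "(v, u) \<in> parcs T" "\<And>y. (v, y) \<in> parcs T \<Longrightarrow> y = u"
proof -
  interpret pair_graph T using T by (simp add: undirected_tree_def)
  define path where "path p \<longleftrightarrow> (\<exists>u v. apath u p v)" for p
  have "path [(a, b)]"
    using arc pair_no_loops[OF arc] wellformed(2)[of "(a, b)"]
    by (auto simp: path_def apath_simps)
  moreover have "\<forall>p. path p \<longrightarrow> length p < card (pverts T)"
    using length_apath_less by (auto simp: path_def)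
  ultimately obtain p where p: "path p" and max: "\<And>q. path q \<Longrightarrow> length q \<le> length p"
    using ex_has_greatest_nat[of path _ length] by (metis less_imp_le)
  have "p \<noteq> []"
    using max[OF \<open>path [(a, b)]\<close>] by auto
  then obtain v u w es where path: "apath v p w" and p_eq: "p = (v, u) # es"
    using p by (cases p) (auto simp: path_def apath_simps)
  have vu: "(v, u) \<in> parcs T" and es: "awalk u es w" "distinct (awalk_verts u es)"
    and v: "v \<notin> set (awalk_verts u es)"
    using path by (auto simp: p_eq apath_def awalk_simps)
  have "y = u" if vy: "(v, y) \<in> parcs T" for y
  proof (rule ccontr)
    assume "y \<noteq> u"
    have yv: "(y, v) \<in> parcs T"
      using vy by (rule arcs_symmetric)
    have "y \<noteq> v"
      using pair_no_loops[OF vy] by simp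
    have "y \<in> set (awalk_verts v p)"
    proof (rule ccontr)
      assume "y \<notin> set (awalk_verts v p)"
      then have "path ((y, v) # p)"
        using path yv by (auto simp: path_def apath_simps)
      then show False
        using max by fastforce
    qed
    then have "y \<in> set (awalk_verts u es)"
      using \<open>y \<noteq> v\<close> by (simp add: p_eq)
    then obtain q r where qr: "es = q @ r" "awalk u q y" "awalk y r w"
      using awalk_decomp[OF es(1)] by blast
    \<comment> \<open>The closed walk runs from \<open>v\<close> to \<open>u\<close>, along
      \<open>q\<close> to \<open>y\<close>, and back to \<open>v\<close>. A non-empty
      \<open>q\<close> gives it the three arcs that separate a genuine cycle from an edge traversed
      back and forth.\<close>
    have "q \<noteq> []"
      using qr(2) \<open>y \<noteq> u\<close> by (auto simp: awalk_simps)
    have ends: "awlast u q = y"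
      using qr(2) by simp
    have sub: "awalk_verts u es = awalk_verts u q @ tl (awalk_verts y r)"
      using es(1) qr ends by (simp add: awalk_verts_append)
    have "awalk u (q @ [(y, v)]) v"
      using qr(2) yv ends vu by (auto simp: awalk_simps dest: wellformed)
    moreover from this have "awalk_verts u (q @ [(y, v)]) = awalk_verts u q @ [v]"
      using awalk_verts_append[of u q "[(y, v)]" v] ends by simp
    ultimately have "cycle ((v, u) # q @ [(y, v)])"
      unfolding cycle_def using vu es(2) v sub
      by (intro exI[of _ v]) (auto simp: awalk_simps)
    moreover have "length ((v, u) # q @ [(y, v)]) \<ge> 3"
      using \<open>q \<noteq> []\<close> by (cases q) auto
    ultimately show False
      using T unfolding undirected_tree_def by blast
  qed
  with vu show thesis by (rule that)
qed

text \<open>An automorphism maps neighbors of \<open>w\<close> to neighbors of \<open>v\<close>, all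
  equal to \<open>u\<close>, and it is injective. This transfers the leaf property from
  \<open>v\<close> back to \<open>w\<close>.\<close>

lemma automorphism_unique_neighbor:
  assumes "pair_graph G" and f: "automorphism G f" and v: "v = f w"
    and leaf: "\<And>y. (v, y) \<in> parcs G \<Longrightarrow> y = u"
    and arcs: "(w, x) \<in> parcs G" "(w, y) \<in> parcs G"
  shows "x = y"
proof -
  interpret pair_graph G by fact
  have "w \<in> pverts G" "x \<in> pverts G" "y \<in> pverts G"
    using arcs by (auto dest: wellformed)
  then have "f x = u" "f y = u"
    using f arcs leaf v by (auto simp: automorphism_def)
  moreover have "inj f"
    using f by (auto simp: automorphism_def intro: permutes_inj)
  ultimately show ?thesis
    by (metis injD)
qed

section \<open>Recoloring around a leaf\<close>

theorem theorem4p5: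
  fixes T :: "'a pair_pre_digraph"
  assumes "undirected_tree T"
    and "uniquely_distinguishing_colorable T"
    and "chi_D T \<ge> 3"
  shows "star T"
proof -
  have G: "pair_graph T" and conn: "connected (with_proj T)"
    using assms(1) by (simp_all add: undirected_tree_def)
  interpret pair_graph T by fact
  obtain P where P: "distinguishing_coloring T (chi_D T) P"
    and unique: "\<And>Q. distinguishing_coloring T (chi_D T) Q \<Longrightarrow> Q = P"
    using assms(2) unfolding uniquely_distinguishing_colorable_def by blast
  have part: "partition_on (pverts T) P" and card: "card P \<ge> 3"
    using P assms(3) unfolding distinguishing_coloring_def by auto
  have class_of: "\<exists>C\<in>P. x \<in> C" if "x \<in> pverts T" for x
    using part that by (auto simp: partition_on_def)
  have third_class: "\<exists>C\<in>P. C \<noteq> A \<and> C \<noteq> B" for A B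
  proof (rule ccontr)
    assume "\<not> ?thesis"
    then have "card P \<le> card {A, B}"
      by (intro card_mono) auto
    also have "\<dots> \<le> 2"
      by (simp add: card_insert_if)
    finally show False
      using card by simp
  qed
  have same: "C = D" if "C \<in> P" "D \<in> P" "x \<in> C" "x \<in> D" for C D x
    using part that by (auto simp: partition_on_def disjoint_def)

  obtain a where a: "a \<in> pverts T"
    using conn by (auto simp: connected_conv)
  obtain A where A: "A \<in> P" "a \<in> A"
    using class_of[OF a] by blast
  obtain C where C: "C \<in> P" "C \<noteq> A"
    using third_class by blast
  \<comment> \<open>Two classes need two vertices; then \<open>{a}\<close> cannot be closed under
    arcs, which yields an edge.\<close>
  have "\<not> pverts T \<subseteq> {a}"
  proof
    assume "pverts T \<subseteq> {a}"
    moreover have "C \<subseteq> pverts T" "C \<noteq> {}"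
      using C part by (auto simp: partition_on_def)
    ultimately have "a \<in> C" by blast
    then show False
      using same A C by blast
  qed
  then obtain b where "(a, b) \<in> parcs T"
    using connected_closed_superset[OF G conn _ a, of "{a}"] by blast
  then obtain v u where vu: "(v, u) \<in> parcs T" and leaf: "\<And>y. (v, y) \<in> parcs T \<Longrightarrow> y = u"
    using undirected_tree_has_leaf[OF assms(1)] by blast
  have verts: "v \<in> pverts T" "u \<in> pverts T" and uv: "(u, v) \<in> parcs T"
    using vu by (auto dest: wellformed arcs_symmetric)

  obtain V U where VU: "V \<in> P" "v \<in> V" "U \<in> P" "u \<in> U"
    using class_of verts by blast
  \<comment> \<open>Avoiding the class of \<open>u\<close>, the only neighbor of \<open>v\<close>,
    makes \<open>W\<close> free to receive \<open>v\<close>.\<close>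
  obtain W where W: "W \<in> P" "W \<noteq> V" "W \<noteq> U"
    using third_class by blast
  have "(v, x) \<notin> parcs T \<and> (x, v) \<notin> parcs T" if "x \<in> W" for x
    using leaf[of x] arcs_symmetric[of x v] same[OF W(1) VU(3)] VU(4) W(3) that by blast
  then have "V = {v}"
    using recoloring_automorphism[OF finite_verts P unique VU(1) W(1) _ VU(2)] W(2) by metis
  have neighbor: "y = u" if w: "(u, w) \<in> parcs T" and y: "(w, y) \<in> parcs T" for w y
  proof (cases "w = v")
    case False
    have wu: "(w, u) \<in> parcs T"
      using w by (rule arcs_symmetric)
    have "w \<in> pverts T"
      using wu by (auto dest: wellformed)
    then obtain D where D: "D \<in> P" "w \<in> D"
      using class_of by blast
    have "D \<noteq> V"
      using D \<open>V = {v}\<close> False by blast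
    have "w \<noteq> u"
      using pair_no_loops[OF w] by simp
    then have "(v, w) \<notin> parcs T" "(w, v) \<notin> parcs T"
      using leaf[of w] arcs_symmetric[of w v] by auto
    then have "(w, x) \<notin> parcs T \<and> (x, w) \<notin> parcs T" if "x \<in> V" for x
      using that by (simp add: \<open>V = {v}\<close>)
    \<comment> \<open>Here \<open>w\<close> moves into \<open>V\<close>; since
      \<open>V = {v}\<close>, the resulting \<open>f\<close> sends \<open>w\<close> to
      \<open>v\<close>.\<close>
    then obtain f where "automorphism T f" "f w \<in> V"
      using recoloring_automorphism[OF finite_verts P unique D(1) VU(1) \<open>D \<noteq> V\<close> D(2)] by metis
    then show ?thesis
      using automorphism_unique_neighbor[OF G _ _ leaf y wu] \<open>V = {v}\<close> by blast
  qed (use leaf y in blast)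

  let ?N = "{w. (u, w) \<in> parcs T}"
  \<comment> \<open>Arcs from \<open>u\<close> end in \<open>?N\<close> by definition, and arcs from
    \<open>?N\<close> return to \<open>u\<close>, so the set is closed.\<close>
  have "pverts T \<subseteq> insert u ?N"
    using connected_closed_superset[OF G conn _ verts(2), of "insert u ?N"] neighbor by blast
  moreover have "?N \<subseteq> pverts T"
    by (auto dest: wellformed)
  ultimately have V_eq: "pverts T = {u} \<union> ?N"
    using verts by blast
  have disj: "{u} \<inter> ?N = {}"
    using pair_no_loops[of "(u, u)"] by auto
  have "parcs T = {u} \<times> ?N \<union> ?N \<times> {u}"
  proof (intro subset_antisym subsetI)
    fix e assume "e \<in> parcs T"
    then obtain x y where e: "e = (x, y)" "(x, y) \<in> parcs T" by (cases e) auto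
    then have "x \<in> {u} \<union> ?N"
      using V_eq wellformed(1)[of e] by auto
    then show "e \<in> {u} \<times> ?N \<union> ?N \<times> {u}"
      using e neighbor by auto
  qed (use arcs_symmetric[of u] in auto)
  then have "K\<^bsub>1,card ?N\<^esub> (with_proj T)"
    using V_eq disj finite_verts card.insert[of "{}" u] unfolding complete_bipartite_digraph_pair_def
    by (metis One_nat_def card.empty empty_iff finite.emptyI)
  moreover have "finite ?N"
    using finite_verts V_eq by simp
  \<comment> \<open>The leaf \<open>v\<close> lies in \<open>?N\<close>.\<close>
  then have "card ?N \<ge> 1"
    using uv by (auto simp: Suc_le_eq card_gt_0_iff)
  ultimately show ?thesis
    unfolding star_def by blast
qed

end
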